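(* There exists an invertible bilateral weighted shift $W$ on an infinite dimensional, separable complex Hilbert space such that $W$ is a strongly compact operator and its inverse $W^{-1}$ is not a strongly compact operator.
   Context: A bilateral weighted shift on a Hilbert space $H$ is a bounded linear operator $W$ with $We_n = w_n e_{n+1}$ for all $n \in \mathbb{Z}$, where $(e_n)_{n \in \mathbb{Z}}$ is an orthonormal basis of $H$ and $(w_n)_{n \in \mathbb{Z}}$ is a bounded sequence of nonzero complex numbers. Let $\mathcal{B}(H)$ be the algebra of bounded linear operators on $H$. A subalgebra $\mathcal{R} \subseteq \mathcal{B}(H)$ is strongly compact if its unit ball $\{R \in \mathcal{R} : \|R\| \leq 1\}$ is precompact (i.e., has compact closure) in the strong operator topology of $\mathcal{B}(H)$. An operator $T \in \mathcal{B}(H)$ is strongly compact if the algebra with identity generated by $T$, namely $\{p(T) : p \text{ a complex polynomial}\}$, is strongly compact. *)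

theory Defs
  imports "HOL-Analysis.Analysis" "HOL-Computational_Algebra.Polynomial"
begin

section \<open>Complex Hilbert spaces\<close>

text \<open>
  A complex inner product space carries its underlying real inner product space structure;
  the real inner product is the real part of the complex one, so that the norm and the topology
  are the ones given by the complex inner product. The inner product is linear in its first argument.
\<close>

class complex_inner = real_inner +
  fixes scaleC :: "complex \<Rightarrow> 'a \<Rightarrow> 'a" (infixr "*\<^sub>C" 75)
    and cinner :: "'a \<Rightarrow> 'a \<Rightarrow> complex"
  assumes scaleC_add_right: "a *\<^sub>C (x + y) = a *\<^sub>C x + a *\<^sub>C y"
    and scaleC_add_left: "(a + b) *\<^sub>C x = a *\<^sub>C x + b *\<^sub>C x"
    and scaleC_scaleC: "a *\<^sub>C b *\<^sub>C x = (a * b) *\<^sub>C x"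
    and scaleC_one: "1 *\<^sub>C x = x"
    and scaleR_scaleC: "r *\<^sub>R x = complex_of_real r *\<^sub>C x"
    and cinner_commute: "cinner x y = cnj (cinner y x)"
    and cinner_add_left: "cinner (x + y) z = cinner x z + cinner y z"
    and cinner_scaleC_left: "cinner (a *\<^sub>C x) y = a * cinner x y"
    and inner_eq_Re_cinner: "inner x y = Re (cinner x y)"

class complex_hilbert = complex_inner + complete_space

global_interpretation complex_vector: vector_space "scaleC :: complex \<Rightarrow> 'a \<Rightarrow> 'a::complex_inner"
  defines cspan = complex_vector.span
  by unfold_locales (simp_all add: scaleC_add_right scaleC_add_left scaleC_scaleC scaleC_one)

definition infinite_dimensional :: "'a::complex_inner itself \<Rightarrow> bool" where
  "infinite_dimensional _ \<longleftrightarrow> \<not> (\<exists>B::'a set. finite B \<and> cspan B = UNIV)"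

definition orthonormal_basis :: "('i \<Rightarrow> 'a::complex_inner) \<Rightarrow> bool" where
  "orthonormal_basis e \<longleftrightarrow>
     (\<forall>i j. cinner (e i) (e j) = (if i = j then 1 else 0)) \<and> closure (cspan (range e)) = UNIV"


section \<open>Operators\<close>

text \<open>
  The type \<open>'a \<Rightarrow>\<^sub>L 'a\<close> consists of the bounded real-linear maps. Since the operator
  norm and the strong operator topology do not depend on the scalar field, the bounded complex-linear
  operators are taken as a subset of it.
\<close>

definition bounded_operators :: "('a::complex_inner \<Rightarrow>\<^sub>L 'a) set" where
  "bounded_operators = {T. \<forall>c x. blinfun_apply T (c *\<^sub>C x) = c *\<^sub>C blinfun_apply T x}"

definition sot :: "('a::complex_inner \<Rightarrow>\<^sub>L 'a) topology" where
  "sot = subtopology strong_operator_topology bounded_operators"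

definition strongly_compact_algebra :: "('a::complex_inner \<Rightarrow>\<^sub>L 'a) set \<Rightarrow> bool" where
  "strongly_compact_algebra R \<longleftrightarrow> compactin sot (sot closure_of {A \<in> R. norm A \<le> 1})"

definition generated_algebra :: "('a::complex_inner \<Rightarrow>\<^sub>L 'a) \<Rightarrow> ('a \<Rightarrow>\<^sub>L 'a) set" where
  "generated_algebra T =
     {A. \<exists>p::complex poly. \<forall>x.
        blinfun_apply A x = (\<Sum>i\<le>degree p. coeff p i *\<^sub>C (blinfun_apply T ^^ i) x)}"

definition strongly_compact_operator :: "('a::complex_inner \<Rightarrow>\<^sub>L 'a) \<Rightarrow> bool" where
  "strongly_compact_operator T \<longleftrightarrow> strongly_compact_algebra (generated_algebra T)"

definition inverse_operators :: "('a::complex_inner \<Rightarrow>\<^sub>L 'a) \<Rightarrow> ('a \<Rightarrow>\<^sub>L 'a) \<Rightarrow> bool" where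
  "inverse_operators A B \<longleftrightarrow>
     A \<in> bounded_operators \<and> B \<in> bounded_operators \<and>
     A o\<^sub>L B = id_blinfun \<and> B o\<^sub>L A = id_blinfun"

definition bilateral_weighted_shift :: "('a::complex_hilbert \<Rightarrow>\<^sub>L 'a) \<Rightarrow> bool" where
  "bilateral_weighted_shift W \<longleftrightarrow>
     W \<in> bounded_operators \<and>
     (\<exists>(e :: int \<Rightarrow> 'a) (w :: int \<Rightarrow> complex).
        orthonormal_basis e \<and> bounded (range w) \<and> (\<forall>n. w n \<noteq> 0) \<and>
        (\<forall>n. blinfun_apply W (e n) = w n *\<^sub>C e (n + 1)))"


section \<open>The Hilbert space of square-summable families\<close>

typedef 'i ell2 = "{x :: 'i \<Rightarrow> complex. (\<lambda>i. (cmod (x i))\<^sup>2) summable_on UNIV}"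
  morphisms coord Abs_ell2
  by (rule exI[of _ "\<lambda>_. 0"]) simp

setup_lifting type_definition_ell2

lemma ell2_summable: "(\<lambda>i. (cmod (coord x i))\<^sup>2) summable_on A"
  using coord[of x] summable_on_subset_banach by blast

lemma square_summable_add:
  fixes x y :: "'i \<Rightarrow> complex"
  assumes "(\<lambda>i. (cmod (x i))\<^sup>2) summable_on UNIV" "(\<lambda>i. (cmod (y i))\<^sup>2) summable_on UNIV"
  shows "(\<lambda>i. (cmod (x i + y i))\<^sup>2) summable_on UNIV"
proof -
  have "(\<lambda>i. 2 * (cmod (x i))\<^sup>2 + 2 * (cmod (y i))\<^sup>2) summable_on UNIV"
    using assms by (intro summable_on_add summable_on_cmult_right)
  moreover have "(cmod (x i + y i))\<^sup>2 \<le> 2 * (cmod (x i))\<^sup>2 + 2 * (cmod (y i))\<^sup>2" for i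
  proof -
    have "(cmod (x i + y i))\<^sup>2 \<le> (cmod (x i) + cmod (y i))\<^sup>2"
      by (intro power_mono norm_triangle_ineq) simp
    also have "\<dots> \<le> 2 * (cmod (x i))\<^sup>2 + 2 * (cmod (y i))\<^sup>2"
      using sum_squares_bound[of "cmod (x i)" "cmod (y i)"] by (simp add: power2_sum)
    finally show ?thesis .
  qed
  ultimately show ?thesis
    by (rule summable_on_comparison_test) auto
qed

lemma square_summable_scale:
  fixes x :: "'i \<Rightarrow> complex"
  assumes "(\<lambda>i. (cmod (x i))\<^sup>2) summable_on UNIV"
  shows "(\<lambda>i. (cmod (c * x i))\<^sup>2) summable_on UNIV"
  using summable_on_cmult_right[OF assms, of "(cmod c)\<^sup>2"] by (simp add: norm_mult power_mult_distrib)

lemma ell2_summable_prod: "(\<lambda>i. coord x i * cnj (coord y i)) summable_on A"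
proof -
  have "(\<lambda>i. (cmod (coord x i))\<^sup>2 + (cmod (coord y i))\<^sup>2) summable_on A"
    by (intro summable_on_add ell2_summable)
  moreover have "norm (coord x i * cnj (coord y i)) \<le> (cmod (coord x i))\<^sup>2 + (cmod (coord y i))\<^sup>2" for i
  proof -
    have "2 * (cmod (coord x i) * cmod (coord y i)) \<le> (cmod (coord x i))\<^sup>2 + (cmod (coord y i))\<^sup>2"
      using sum_squares_bound[of "cmod (coord x i)" "cmod (coord y i)"] by simp
    moreover have "0 \<le> cmod (coord x i) * cmod (coord y i)" by simp
    ultimately have "cmod (coord x i) * cmod (coord y i) \<le> (cmod (coord x i))\<^sup>2 + (cmod (coord y i))\<^sup>2"
      by linarith
    then show ?thesis by (simp add: norm_mult)
  qed
  ultimately have "(\<lambda>i. norm (coord x i * cnj (coord y i))) summable_on A"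
    by (rule summable_on_comparison_test) auto
  then show ?thesis by (rule abs_summable_summable)
qed

instantiation ell2 :: (type) real_vector
begin

lift_definition zero_ell2 :: "'a ell2" is "\<lambda>_. 0" by simp

lift_definition plus_ell2 :: "'a ell2 \<Rightarrow> 'a ell2 \<Rightarrow> 'a ell2" is "\<lambda>x y i. x i + y i"
  by (rule square_summable_add)

lift_definition uminus_ell2 :: "'a ell2 \<Rightarrow> 'a ell2" is "\<lambda>x i. - x i" by simp

lift_definition minus_ell2 :: "'a ell2 \<Rightarrow> 'a ell2 \<Rightarrow> 'a ell2" is "\<lambda>x y i. x i - y i"
  subgoal for x y using square_summable_add[of x "\<lambda>i. - y i"] by simp
  done

lift_definition scaleR_ell2 :: "real \<Rightarrow> 'a ell2 \<Rightarrow> 'a ell2" is "\<lambda>r x i. complex_of_real r * x i"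
  by (rule square_summable_scale)

instance
  by standard (transfer; simp add: fun_eq_iff algebra_simps)+

end

instantiation ell2 :: (type) complex_inner
begin

lift_definition scaleC_ell2 :: "complex \<Rightarrow> 'a ell2 \<Rightarrow> 'a ell2" is "\<lambda>c x i. c * x i"
  by (rule square_summable_scale)

definition cinner_ell2 :: "'a ell2 \<Rightarrow> 'a ell2 \<Rightarrow> complex"
  where "cinner_ell2 x y = (\<Sum>\<^sub>\<infinity>i. coord x i * cnj (coord y i))"

definition inner_ell2 :: "'a ell2 \<Rightarrow> 'a ell2 \<Rightarrow> real"
  where "inner_ell2 x y = Re (cinner x y)"

definition norm_ell2 :: "'a ell2 \<Rightarrow> real"
  where "norm_ell2 x = sqrt (inner x x)"

definition sgn_ell2 :: "'a ell2 \<Rightarrow> 'a ell2"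
  where "sgn_ell2 x = scaleR (inverse (norm x)) x"

definition dist_ell2 :: "'a ell2 \<Rightarrow> 'a ell2 \<Rightarrow> real"
  where "dist_ell2 x y = norm (x - y)"

definition uniformity_ell2 :: "('a ell2 \<times> 'a ell2) filter"
  where "uniformity_ell2 = (INF e\<in>{0<..}. principal {(x, y). dist x y < e})"

definition open_ell2 :: "'a ell2 set \<Rightarrow> bool"
  where "open_ell2 U \<longleftrightarrow> (\<forall>x\<in>U. eventually (\<lambda>(x', y). x' = x \<longrightarrow> y \<in> U) uniformity)"

lemma inner_self_ell2: "inner x x = (\<Sum>\<^sub>\<infinity>i. (cmod (coord x i))\<^sup>2)" for x :: "'a ell2"
proof -
  have "cinner x x = (\<Sum>\<^sub>\<infinity>i. complex_of_real ((cmod (coord x i))\<^sup>2))"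
    by (simp only: cinner_ell2_def complex_norm_square)
  also have "\<dots> = complex_of_real (\<Sum>\<^sub>\<infinity>i. (cmod (coord x i))\<^sup>2)"
    by (rule infsumI, rule has_sum_of_real, rule has_sum_infsum, rule ell2_summable)
  finally show ?thesis by (simp add: inner_ell2_def)
qed

instance
proof
  fix x y z :: "'a ell2" and a b :: complex and r s :: real
  show "a *\<^sub>C (x + y) = a *\<^sub>C x + a *\<^sub>C y" for a :: complex and x y :: "'a ell2"
    by transfer (simp add: distrib_left)
  show "(a + b) *\<^sub>C x = a *\<^sub>C x + b *\<^sub>C x" for a b :: complex and x :: "'a ell2"
    by transfer (simp add: distrib_right)
  show "a *\<^sub>C b *\<^sub>C x = (a * b) *\<^sub>C x" for a b :: complex and x :: "'a ell2"
    by transfer (simp add: mult.assoc)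
  show "1 *\<^sub>C x = x" for x :: "'a ell2"
    by transfer simp
  show R: "r *\<^sub>R x = complex_of_real r *\<^sub>C x" for r :: real and x :: "'a ell2"
    by transfer (rule refl)
  show I1: "cinner x y = cnj (cinner y x)" for x y :: "'a ell2"
  proof -
    have "cnj (cinner y x) = (\<Sum>\<^sub>\<infinity>i. cnj (coord y i * cnj (coord x i)))"
      unfolding cinner_ell2_def by (rule infsum_cnj[symmetric])
    then show ?thesis by (simp add: cinner_ell2_def mult.commute)
  qed
  show I2: "cinner (x + y) z = cinner x z + cinner y z"
    by (simp add: cinner_ell2_def plus_ell2.rep_eq distrib_right infsum_add ell2_summable_prod)
  show I3: "cinner (a *\<^sub>C x) y = a * cinner x y" for a :: complex
    by (simp add: cinner_ell2_def scaleC_ell2.rep_eq mult.assoc infsum_cmult_right ell2_summable_prod)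
  show "inner x y = Re (cinner x y)" by (rule inner_ell2_def)
  show "inner x y = inner y x"
    using arg_cong[OF I1[of x y], of Re] by (simp add: inner_ell2_def)
  show "inner (x + y) z = inner x z + inner y z"
    by (simp add: inner_ell2_def I2)
  show "inner (r *\<^sub>R x) y = r * inner x y"
    by (simp add: inner_ell2_def R I3)
  show "0 \<le> inner x x"
    unfolding inner_self_ell2 by (rule infsum_nonneg) simp
  show "inner x x = 0 \<longleftrightarrow> x = 0"
  proof
    assume "inner x x = 0"
    then have *: "(\<Sum>\<^sub>\<infinity>i. (cmod (coord x i))\<^sup>2) = 0" by (simp add: inner_self_ell2)
    have "coord x i = 0" for i
      using nonneg_infsum_le_0D[of "\<lambda>i. (cmod (coord x i))\<^sup>2" UNIV i] * ell2_summable[of x UNIV]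
      by simp
    then show "x = 0" by (intro coord_inject[THEN iffD1] ext) (simp add: zero_ell2.rep_eq)
  qed (simp add: inner_self_ell2 zero_ell2.rep_eq)
  show "norm x = sqrt (inner x x)" by (rule norm_ell2_def)
  show "sgn x = x /\<^sub>R norm x" by (rule sgn_ell2_def)
  show "dist x y = norm (x - y)" by (rule dist_ell2_def)
  show "(uniformity :: ('a ell2 \<times> 'a ell2) filter) = (INF e\<in>{0<..}. principal {(x, y). dist x y < e})"
    by (rule uniformity_ell2_def)
  show "open U \<longleftrightarrow> (\<forall>x\<in>U. eventually (\<lambda>(x', y). x' = x \<longrightarrow> y \<in> U) uniformity)" for U :: "'a ell2 set"
    by (rule open_ell2_def)
qed

end

lemma norm_ell2_squared: "(norm x)\<^sup>2 = (\<Sum>\<^sub>\<infinity>i. (cmod (coord x i))\<^sup>2)" for x :: "'i ell2"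
  by (simp add: power2_norm_eq_inner inner_self_ell2)

lemma finite_sum_le_norm_ell2:
  "finite F \<Longrightarrow> (\<Sum>i\<in>F. (cmod (coord x i))\<^sup>2) \<le> (norm x)\<^sup>2" for x :: "'i ell2"
  unfolding norm_ell2_squared by (rule finite_sum_le_infsum) (auto intro: ell2_summable)

lemma coord_le_norm_ell2: "cmod (coord x i) \<le> norm x" for x :: "'i ell2"
  by (rule power2_le_imp_le) (use finite_sum_le_norm_ell2[of "{i}" x] in simp_all)

instance ell2 :: (type) complex_hilbert
proof
  fix X :: "nat \<Rightarrow> 'a ell2"
  assume X: "Cauchy X"
  have "Cauchy (\<lambda>n. coord (X n) i)" for i
  proof (rule metric_CauchyI)
    fix e :: real assume "0 < e"
    then obtain N where N: "\<And>m n. m \<ge> N \<Longrightarrow> n \<ge> N \<Longrightarrow> dist (X m) (X n) < e"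
      using metric_CauchyD[OF X] by blast
    have "dist (coord (X m) i) (coord (X n) i) < e" if "m \<ge> N" "n \<ge> N" for m n
      using N[OF that] coord_le_norm_ell2[of "X m - X n" i]
      by (simp add: dist_norm minus_ell2.rep_eq)
    then show "\<exists>M. \<forall>m\<ge>M. \<forall>n\<ge>M. dist (coord (X m) i) (coord (X n) i) < e" by blast
  qed
  then have "\<forall>i. \<exists>l. (\<lambda>n. coord (X n) i) \<longlonglongrightarrow> l"
    using Cauchy_convergent convergent_def by blast
  then obtain l where l: "\<And>i. (\<lambda>n. coord (X n) i) \<longlonglongrightarrow> l i" by metis
  have close: "\<exists>N. \<forall>n\<ge>N. \<forall>F. finite F \<longrightarrow> (\<Sum>i\<in>F. (cmod (l i - coord (X n) i))\<^sup>2) \<le> e\<^sup>2"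
    if e: "0 < e" for e :: real
  proof -
    obtain N where N: "\<And>m n. m \<ge> N \<Longrightarrow> n \<ge> N \<Longrightarrow> dist (X m) (X n) < e"
      using metric_CauchyD[OF X e] by blast
    have "(\<Sum>i\<in>F. (cmod (l i - coord (X n) i))\<^sup>2) \<le> e\<^sup>2" if n: "n \<ge> N" and F: "finite F" for n F
    proof (rule LIMSEQ_le_const2)
      show "(\<lambda>m. \<Sum>i\<in>F. (cmod (coord (X m) i - coord (X n) i))\<^sup>2)
              \<longlonglongrightarrow> (\<Sum>i\<in>F. (cmod (l i - coord (X n) i))\<^sup>2)"
        by (intro tendsto_intros l)
      have "(\<Sum>i\<in>F. (cmod (coord (X m) i - coord (X n) i))\<^sup>2) \<le> e\<^sup>2" if m: "m \<ge> N" for m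
      proof -
        have "(\<Sum>i\<in>F. (cmod (coord (X m) i - coord (X n) i))\<^sup>2) \<le> (norm (X m - X n))\<^sup>2"
          using finite_sum_le_norm_ell2[OF F, of "X m - X n"] by (simp add: minus_ell2.rep_eq)
        also have "\<dots> \<le> e\<^sup>2"
          using N[OF m n] by (intro power_mono) (simp_all add: dist_norm)
        finally show ?thesis .
      qed
      then show "\<exists>M. \<forall>m\<ge>M. (\<Sum>i\<in>F. (cmod (coord (X m) i - coord (X n) i))\<^sup>2) \<le> e\<^sup>2" by blast
    qed
    then show ?thesis by blast
  qed
  have summ: "(\<lambda>i. (cmod (l i - coord (X n) i))\<^sup>2) summable_on UNIV"
    if "\<forall>F. finite F \<longrightarrow> (\<Sum>i\<in>F. (cmod (l i - coord (X n) i))\<^sup>2) \<le> e\<^sup>2" for n and e :: real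
    using that by (intro nonneg_bdd_above_summable_on bdd_aboveI2[where M = "e\<^sup>2"]) auto
  obtain N where "\<forall>F. finite F \<longrightarrow> (\<Sum>i\<in>F. (cmod (l i - coord (X N) i))\<^sup>2) \<le> 1\<^sup>2"
    using close[of 1] by auto
  from square_summable_add[OF summ[OF this] ell2_summable[of "X N"]]
  have lsum: "(\<lambda>i. (cmod (l i))\<^sup>2) summable_on UNIV" by simp
  define L where "L = Abs_ell2 l"
  have L: "coord L = l" unfolding L_def using lsum by (simp add: Abs_ell2_inverse)
  have "X \<longlonglongrightarrow> L"
  proof (rule metric_LIMSEQ_I)
    fix r :: real assume r: "0 < r"
    then obtain N where N: "\<And>n F. n \<ge> N \<Longrightarrow> finite F \<Longrightarrow>
        (\<Sum>i\<in>F. (cmod (l i - coord (X n) i))\<^sup>2) \<le> (r / 2)\<^sup>2"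
      using close[of "r / 2"] by auto
    have "dist (X n) L < r" if n: "n \<ge> N" for n
    proof -
      have "(norm (L - X n))\<^sup>2 = (\<Sum>\<^sub>\<infinity>i. (cmod (l i - coord (X n) i))\<^sup>2)"
        by (simp add: norm_ell2_squared minus_ell2.rep_eq L)
      also have "\<dots> \<le> (r / 2)\<^sup>2"
        using N[OF n] by (intro infsum_le_finite_sums summ) auto
      finally have "norm (L - X n) \<le> r / 2"
        by (rule power2_le_imp_le) (use r in simp)
      then show ?thesis using r by (simp add: dist_norm norm_minus_commute)
    qed
    then show "\<exists>N. \<forall>n\<ge>N. dist (X n) L < r" by blast
  qed
  then show "convergent X" by (rule convergentI)
qed

end

theory Submission
  imports Defs
begin

text \<open>
  Take \<open>w\<^sub>n = 1\<close> for \<open>n < 0\<close> and \<open>w\<^sub>n = 2(n+1)/(n+2)\<close> for \<open>n \<ge> 0\<close>. All weights are at least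
  1, so \<open>W\<^sup>-\<^sup>1\<close> is a contraction, and its powers send \<open>e\<^sub>0\<close> to the orthonormal vectors \<open>e\<^sub>-\<^sub>j\<close>;
  hence \<open>W\<^sup>-\<^sup>1\<close> is not strongly compact. For \<open>W\<close>, let \<open>A\<close> be a contraction commuting with \<open>W\<close>
  such that \<open>A e\<^sub>0\<close> lives on the nonnegative coordinates. Since \<open>\<beta>\<^sub>n = w\<^sub>0\<cdots>w\<^sub>n\<^sub>-\<^sub>1 = 2\<^sup>n/(n+1)\<close>
  satisfies \<open>\<beta>\<^sub>j \<beta>\<^sub>m \<le> 2/(m+1) \<beta>\<^sub>j\<^sub>+\<^sub>m\<close> for \<open>j \<ge> m\<close>, comparing \<open>A e\<^sub>0\<close> with \<open>A W\<^sup>m e\<^sub>0 = W\<^sup>m A e\<^sub>0\<close> shows that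
  the tail of \<open>A e\<^sub>0\<close> beyond \<open>m\<close> has norm at most \<open>2/(m+1)\<close>, uniformly in \<open>A\<close>. So the vectors
  \<open>A e\<^sub>0\<close> form a precompact set; commutation spreads this to the orbits \<open>A x\<close> of all vectors, and
  Tychonoff's theorem gives compactness in the strong operator topology.
\<close>

section \<open>Vectors and weighted translations of square-summable families\<close>

lemma coord_simps [simp]:
  "coord 0 i = 0" "coord (x + y) i = coord x i + coord y i"
  "coord (x - y) i = coord x i - coord y i" "coord (c *\<^sub>C x) i = c * coord x i"
  "coord (r *\<^sub>R x) i = complex_of_real r * coord x i"
  by (simp_all add: zero_ell2.rep_eq plus_ell2.rep_eq minus_ell2.rep_eq scaleC_ell2.rep_eq
      scaleR_ell2.rep_eq)

lemma coord_sum [simp]: "coord (sum f A) i = (\<Sum>a\<in>A. coord (f a) i)"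
  by (induction A rule: infinite_finite_induct) auto

lemma ell2_eqI: "(\<And>i. coord x i = coord y i) \<Longrightarrow> x = y"
  by (metis coord_inject ext)

lemma bounded_linear_coord: "bounded_linear (\<lambda>x. coord x i)"
  by (rule bounded_linear_intro[of _ 1]) (auto simp: coord_le_norm_ell2 scaleR_conv_of_real)

lemma norm_scaleC: "norm (c *\<^sub>C x) = cmod c * norm x" for x :: "'i ell2"
proof -
  have "(norm (c *\<^sub>C x))\<^sup>2 = (cmod c * norm x)\<^sup>2"
    by (simp add: norm_ell2_squared norm_mult power_mult_distrib infsum_cmult_right')
  then show ?thesis by simp
qed

lemma bounded_linear_scaleC_right: "bounded_linear (\<lambda>x. c *\<^sub>C x :: 'i ell2)"
  by (rule bounded_linear_intro[of _ "cmod c"])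
    (auto simp: norm_scaleC scaleR_scaleC scaleC_add_right scaleC_scaleC mult.commute)

lemma bounded_linear_scaleC_left: "bounded_linear (\<lambda>c. c *\<^sub>C x :: 'i ell2)"
  by (rule bounded_linear_intro[of _ "norm x"])
    (auto simp: norm_scaleC scaleR_scaleC scaleC_add_left scaleC_scaleC scaleR_conv_of_real)

text \<open>Injectivity of \<open>g\<close> makes the reindexed sum a partial sum of the squared
  norm of \<open>z\<close>. This one estimate yields both square summability and operator norm
  bounds.\<close>

lemma sum_squares_dominated:
  assumes "inj g" "\<And>i. cmod (y i) \<le> c * cmod (coord z (g i))" "finite F"
  shows "(\<Sum>i\<in>F. (cmod (y i))\<^sup>2) \<le> (c * norm z)\<^sup>2"
proof -
  have "(\<Sum>i\<in>F. (cmod (y i))\<^sup>2) \<le> (\<Sum>i\<in>F. (c * cmod (coord z (g i)))\<^sup>2)"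
    using assms(2) by (intro sum_mono power_mono) auto
  also have "\<dots> = c\<^sup>2 * (\<Sum>i\<in>g ` F. (cmod (coord z i))\<^sup>2)"
    using assms(1) by (simp add: sum.reindex inj_on_subset sum_distrib_left power_mult_distrib)
  also have "\<dots> \<le> c\<^sup>2 * (norm z)\<^sup>2"
    using assms(3) by (intro mult_left_mono finite_sum_le_norm_ell2) auto
  finally show ?thesis by (simp add: power_mult_distrib)
qed

lemma summable_dominated:
  assumes "inj g" "\<And>i. cmod (y i) \<le> c * cmod (coord z (g i))"
  shows "(\<lambda>i. (cmod (y i))\<^sup>2) summable_on UNIV"
  using sum_squares_dominated[OF assms]
  by (intro nonneg_bdd_above_summable_on bdd_aboveI2[where M = "(c * norm z)\<^sup>2"]) auto

lemma norm_dominated: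
  assumes "inj g" "\<And>i. cmod (coord y i) \<le> c * cmod (coord z (g i))" "0 \<le> c"
  shows "norm y \<le> c * norm z"
proof (rule power2_le_imp_le)
  show "(norm y)\<^sup>2 \<le> (c * norm z)\<^sup>2"
    unfolding norm_ell2_squared[of y]
    by (intro infsum_le_finite_sums ell2_summable sum_squares_dominated[OF assms(1,2)])
qed (use assms(3) in simp)

section \<open>Unit vectors, orthonormal basis and infinite dimension\<close>

definition unit_vector :: "'i \<Rightarrow> 'i ell2" where
  "unit_vector i = Abs_ell2 (\<lambda>j. if j = i then 1 else 0)"

lemma coord_unit_vector [simp]: "coord (unit_vector i) j = (if j = i then 1 else 0)"
proof -
  have "(\<lambda>j. (cmod (if j = i then 1 else 0))\<^sup>2) summable_on UNIV"
    by (rule finite_nonzero_values_imp_summable_on)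
      (rule finite_subset[of _ "{i}"], auto split: if_splits)
  then show ?thesis by (simp add: unit_vector_def Abs_ell2_inverse)
qed

lemma cinner_unit_vector_right: "cinner x (unit_vector i) = coord x i"
proof -
  have "cinner x (unit_vector i) = (\<Sum>\<^sub>\<infinity>j\<in>{i}. coord x j)"
    unfolding cinner_ell2_def by (rule infsum_cong_neutral) auto
  then show ?thesis by simp
qed

lemma norm_unit_vector [simp]: "norm (unit_vector i) = 1"
  by (simp add: norm_eq_sqrt_inner inner_eq_Re_cinner cinner_unit_vector_right)

text \<open>The squared norm of the remainder is the squared norm of \<open>x\<close> minus a
  partial sum of the series converging to it.\<close>

lemma finite_truncation_approx:
  assumes "0 < (\<epsilon>::real)"
  shows "\<exists>F. finite F \<and> norm (x - (\<Sum>i\<in>F. coord x i *\<^sub>C unit_vector i)) < \<epsilon>"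
proof -
  have "((\<lambda>F. \<Sum>i\<in>F. (cmod (coord x i))\<^sup>2) \<longlongrightarrow> (norm x)\<^sup>2) (finite_subsets_at_top UNIV)"
    using has_sum_infsum[OF ell2_summable[of x UNIV]] by (simp add: has_sum_def norm_ell2_squared)
  then have "\<forall>\<^sub>F F in finite_subsets_at_top UNIV. \<bar>(\<Sum>i\<in>F. (cmod (coord x i))\<^sup>2) - (norm x)\<^sup>2\<bar> < \<epsilon>\<^sup>2"
    using assms by (auto simp: tendsto_iff dist_real_def dest!: spec[of _ "\<epsilon>\<^sup>2"])
  then obtain F where F: "finite F" "\<bar>(\<Sum>i\<in>F. (cmod (coord x i))\<^sup>2) - (norm x)\<^sup>2\<bar> < \<epsilon>\<^sup>2"
    by (auto simp: eventually_finite_subsets_at_top)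
  let ?y = "x - (\<Sum>i\<in>F. coord x i *\<^sub>C unit_vector i)"
  have y: "coord ?y j = (if j \<in> F then 0 else coord x j)" for j
    using F(1) by (simp add: if_distrib[of "(*) _"] cong: if_cong)
  have "(norm ?y)\<^sup>2 = (\<Sum>\<^sub>\<infinity>j\<in>UNIV - F. (cmod (coord x j))\<^sup>2)"
    unfolding norm_ell2_squared by (rule infsum_cong_neutral) (auto simp: y simp del: coord_simps coord_sum)
  also have "\<dots> = (norm x)\<^sup>2 - (\<Sum>i\<in>F. (cmod (coord x i))\<^sup>2)"
    unfolding norm_ell2_squared using F(1) by (subst infsum_Diff) (auto intro: ell2_summable)
  also have "\<dots> < \<epsilon>\<^sup>2" using F(2) by linarith
  finally show ?thesis using F(1) assms by (metis less_imp_le power2_less_imp_less)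
qed

lemma sum_unit_vectors_in_cspan: "(\<Sum>i\<in>F. c i *\<^sub>C unit_vector i) \<in> cspan (range unit_vector)"
  by (intro complex_vector.span_sum complex_vector.span_scale complex_vector.span_base rangeI)

lemma orthonormal_basis_unit_vector: "orthonormal_basis (unit_vector :: 'i \<Rightarrow> 'i ell2)"
  unfolding orthonormal_basis_def
proof (intro conjI)
  show "closure (cspan (range unit_vector)) = (UNIV :: 'i ell2 set)"
  proof (intro set_eqI iffI UNIV_I)
    fix x :: "'i ell2"
    show "x \<in> closure (cspan (range unit_vector))"
      unfolding closure_approachable dist_norm
      using finite_truncation_approx[of _ x] sum_unit_vectors_in_cspan norm_minus_commute by metis
  qed
qed (auto simp: cinner_unit_vector_right)

lemma infinite_dimensional_ell2:
  assumes "infinite (UNIV :: 'i set)"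
  shows "infinite_dimensional TYPE('i ell2)"
  unfolding infinite_dimensional_def
proof (intro notI, elim exE conjE)
  fix B :: "'i ell2 set" assume B: "finite B" "cspan B = UNIV"
  \<comment> \<open>Coordinate \<open>i\<close> vanishes on the span of the other unit vectors but
    is 1 at \<open>unit_vector i\<close>. So the unit vectors are independent, and a finite spanning
    set would bound their number.\<close>
  have "coord x i = 0" if "x \<in> cspan (range unit_vector - {unit_vector i})" for x and i :: 'i
    using that
    by (induction rule: complex_vector.span_induct_alt) (auto split: if_splits)
  then have "complex_vector.independent (range (unit_vector :: 'i \<Rightarrow> 'i ell2))"
    unfolding complex_vector.dependent_def by fastforce
  then have "finite (range (unit_vector :: 'i \<Rightarrow> 'i ell2))"
    using complex_vector.independent_span_bound[OF B(1)] B(2) by auto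
  moreover have "inj (unit_vector :: 'i \<Rightarrow> 'i ell2)"
  proof (rule injI)
    fix i j :: 'i assume "unit_vector i = unit_vector j"
    then have "coord (unit_vector i) i = coord (unit_vector j) i" by simp
    then show "i = j" by (simp split: if_splits)
  qed
  ultimately show False using assms by (simp add: finite_image_iff)
qed

section \<open>Bounded finite combinations and separability\<close>

text \<open>Each new index adds the compact image of a disc, and sums of compact sets are compact.
  Used for separability and for the orbit of \<open>unit_vector 0\<close>.\<close>

lemma compact_bounded_combinations:
  assumes "finite J"
  shows "\<exists>C. compact C \<and> (\<forall>c. (\<forall>j\<in>J. cmod (c j) \<le> r) \<longrightarrow> (\<Sum>j\<in>J. c j *\<^sub>C v j :: 'i ell2) \<in> C)"
  using assms
proof induction
  case empty
  then show ?case by (intro exI[of _ "{0}"]) auto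
next
  case (insert k J)
  then obtain C where C: "compact C" "\<And>c. \<forall>j\<in>J. cmod (c j) \<le> r \<Longrightarrow> (\<Sum>j\<in>J. c j *\<^sub>C v j) \<in> C"
    by blast
  let ?D = "(\<lambda>c. c *\<^sub>C v k) ` cball 0 r"
  have "compact ?D"
    by (intro compact_continuous_image linear_continuous_on bounded_linear_scaleC_left) simp
  then have "compact {x + y | x y. x \<in> ?D \<and> y \<in> C}" using C(1) by (rule compact_sums)
  then show ?case using C(2) insert.hyps
    by (intro exI[of _ "{x + y | x y. x \<in> ?D \<and> y \<in> C}"]) fastforce
qed

text \<open>The combinations with indices in \<open>{-n..n}\<close> and coefficients of modulus at
  most \<open>n\<close> lie in a compact, hence totally bounded, set \<open>C n\<close>. The union
  over \<open>n\<close> and \<open>l\<close> of finite \<open>1/(l+1)\<close>-nets of these sets is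
  countable and dense.\<close>

lemma separable_space_ell2: "separable_space (euclidean :: int ell2 topology)"
proof -
  have "\<exists>C. compact C \<and> (\<forall>c. (\<forall>j\<in>{-int n..int n}. cmod (c j) \<le> real n) \<longrightarrow>
      (\<Sum>j\<in>{-int n..int n}. c j *\<^sub>C unit_vector j :: int ell2) \<in> C)" for n
    by (rule compact_bounded_combinations) simp
  then obtain C :: "nat \<Rightarrow> int ell2 set" where C: "\<And>n. compact (C n)"
    "\<And>n c. (\<forall>j\<in>{-int n..int n}. cmod (c j) \<le> real n) \<Longrightarrow>
      (\<Sum>j\<in>{-int n..int n}. c j *\<^sub>C unit_vector j) \<in> C n" by metis
  have "\<exists>k. finite k \<and> C n \<subseteq> (\<Union>x\<in>k. ball x (1 / real (Suc l)))" for n l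
    using C(1)[of n] by (simp add: compact_eq_totally_bounded)
  then obtain k where k: "\<And>n l. finite (k n l)" "\<And>n l. C n \<subseteq> (\<Union>x\<in>k n l. ball x (1 / real (Suc l)))"
    by metis
  let ?K = "\<Union>n. \<Union>l. k n l"
  have "x \<in> closure ?K" for x
    unfolding closure_approachable
  proof (intro allI impI)
    fix \<epsilon> :: real assume "0 < \<epsilon>"
    then obtain F where F: "finite F" "norm (x - (\<Sum>i\<in>F. coord x i *\<^sub>C unit_vector i)) < \<epsilon> / 2"
      using finite_truncation_approx[of "\<epsilon> / 2" x] by auto
    obtain N where N: "norm x \<le> real N" using real_arch_simple by blast
    obtain M where M: "F \<subseteq> {- int M..int M}"
    proof
      show "F \<subseteq> {- int (Max (insert 0 ((\<lambda>i. nat \<bar>i\<bar>) ` F)))..int (Max (insert 0 ((\<lambda>i. nat \<bar>i\<bar>) ` F)))}"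
      proof
        fix i assume "i \<in> F"
        then have "nat \<bar>i\<bar> \<le> Max (insert 0 ((\<lambda>i. nat \<bar>i\<bar>) ` F))" using F(1) by (intro Max_ge) auto
        then show "i \<in> {- int (Max (insert 0 ((\<lambda>i. nat \<bar>i\<bar>) ` F)))..int (Max (insert 0 ((\<lambda>i. nat \<bar>i\<bar>) ` F)))}"
          by auto
      qed
    qed
    \<comment> \<open>One \<open>n\<close> has to cover the index range of \<open>F\<close> as well
      as the size of the coefficients; padding with zeros leaves the sum unchanged.\<close>
    let ?n = "max M N" and ?c = "\<lambda>j. if j \<in> F then coord x j else 0"
    let ?y = "\<Sum>j\<in>{- int ?n..int ?n}. ?c j *\<^sub>C (unit_vector j :: int ell2)"
    have "?y \<in> C ?n"
    proof (intro C(2) ballI)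
      fix j
      show "cmod (?c j) \<le> real ?n" using N coord_le_norm_ell2[of x j] by (auto simp: max_def)
    qed
    moreover have "?y = (\<Sum>j\<in>F. coord x j *\<^sub>C unit_vector j)"
    proof (intro sum.mono_neutral_cong_right)
      show "F \<subseteq> {- int ?n..int ?n}" using M by (rule order.trans) auto
    qed auto
    moreover obtain l where l: "1 / real (Suc l) < \<epsilon> / 2"
      using \<open>0 < \<epsilon>\<close> nat_approx_posE[of "\<epsilon> / 2"] by auto
    ultimately obtain z where "z \<in> k ?n l" "dist z (\<Sum>j\<in>F. coord x j *\<^sub>C unit_vector j) < 1 / real (Suc l)"
      using k(2)[of ?n l] by (auto simp: subset_iff)
    moreover have "dist (\<Sum>j\<in>F. coord x j *\<^sub>C unit_vector j) x < \<epsilon> / 2"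
      using F(2) by (simp add: dist_norm norm_minus_commute)
    ultimately have "z \<in> ?K" "dist z x < \<epsilon>"
      using l dist_triangle[of z x "\<Sum>j\<in>F. coord x j *\<^sub>C unit_vector j"] by auto
    then show "\<exists>y\<in>?K. dist y x < \<epsilon>" by blast
  qed
  moreover have "countable ?K" by (simp add: k(1) countable_finite)
  ultimately show ?thesis
    unfolding separable_space_def by (intro exI[of _ ?K]) auto
qed

section \<open>Weighted translations as bounded operators\<close>

text \<open>Coordinate \<open>i\<close> is read off from \<open>i + k\<close>, so
  \<open>k = -1\<close> moves basis vectors forward. \<open>Abs_ell2\<close> and
  \<open>Blinfun\<close> are total; their arguments are shown to be legitimate below for bounded
  \<open>a\<close>.\<close>

definition weighted_translation :: "(int \<Rightarrow> complex) \<Rightarrow> int \<Rightarrow> int ell2 \<Rightarrow>\<^sub>L int ell2" where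
  "weighted_translation a k = Blinfun (\<lambda>x. Abs_ell2 (\<lambda>i. a i * coord x (i + k)))"

lemma
  assumes "\<And>i. cmod (a i) \<le> c"
  shows coord_weighted_translation:
      "coord (weighted_translation a k x) i = a i * coord x (i + k)"
    and weighted_translation_in_bounded_operators: "weighted_translation a k \<in> bounded_operators"
    and norm_weighted_translation: "norm (weighted_translation a k) \<le> c"
proof -
  have c: "0 \<le> c" using norm_ge_zero assms order.trans by blast
  have inj: "inj (\<lambda>i::int. i + k)" by (simp add: inj_def)
  have dom: "cmod (a i * coord x (i + k)) \<le> c * cmod (coord x (i + k))" for x i
    by (simp add: norm_mult assms mult_right_mono)
  let ?T = "\<lambda>x. Abs_ell2 (\<lambda>i. a i * coord x (i + k))"
  have T: "coord (?T x) i = a i * coord x (i + k)" for x i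
    using summable_dominated[OF inj dom] by (simp add: Abs_ell2_inverse)
  have bound: "norm (?T x) \<le> c * norm x" for x
    by (rule norm_dominated[OF inj _ c]) (simp only: T dom)
  have "bounded_linear ?T"
  proof (rule bounded_linear_intro)
    show "?T (x + y) = ?T x + ?T y" for x y
      by (rule ell2_eqI) (simp only: T, simp add: T distrib_left)
    show "?T (r *\<^sub>R x) = r *\<^sub>R ?T x" for r x
      by (rule ell2_eqI) (simp only: T, simp add: T)
    show "norm (?T x) \<le> norm x * c" for x
      using bound by (simp only: mult.commute)
  qed
  then have W: "blinfun_apply (weighted_translation a k) = ?T"
    unfolding weighted_translation_def by (rule bounded_linear_Blinfun_apply)
  show "coord (weighted_translation a k x) i = a i * coord x (i + k)" for x i
    by (simp add: W T)
  show "weighted_translation a k \<in> bounded_operators"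
    unfolding bounded_operators_def mem_Collect_eq W
    by (intro allI ell2_eqI) (simp only: T, simp add: T)
  show "norm (weighted_translation a k) \<le> c"
    using c bound by (intro norm_blinfun_bound) (simp_all add: W)
qed

section \<open>Compactness in the strong operator topology\<close>

text \<open>Tychonoff: \<open>F\<close> is a closed subset of a product of compact sets.\<close>

lemma compact_pointwise_bounded:
  fixes F :: "('a \<Rightarrow> 'b::metric_space) set"
  assumes "closed F" and "\<And>x. \<exists>C. compact C \<and> (\<forall>f\<in>F. f x \<in> C)"
  shows "compact F"
proof -
  obtain C where C: "\<And>x. compact (C x)" "\<And>x f. f \<in> F \<Longrightarrow> f x \<in> C x"
    using assms(2) by metis
  have "compactin euclidean (PiE UNIV C)"
    unfolding euclidean_product_topology[symmetric] compactin_PiE using C(1) by simp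
  moreover have "F \<subseteq> PiE UNIV C" using C(2) by auto
  ultimately show ?thesis
    using assms(1) by (metis closed_closedin closed_compactin compactin_euclidean_iff)
qed

text \<open>The strong operator topology is that of pointwise convergence, so \<open>Blinfun\<close>
  is continuous on \<open>F\<close> and transports compactness from the function space.\<close>

lemma compactin_sot_Blinfun_image:
  fixes F :: "('a::complex_inner \<Rightarrow> 'a) set"
  assumes "compact F" "\<And>f. f \<in> F \<Longrightarrow> bounded_linear f"
    and "\<And>f c x. f \<in> F \<Longrightarrow> f (c *\<^sub>C x) = c *\<^sub>C f x"
  shows "compactin sot (Blinfun ` F)"
proof (rule image_compactin)
  show "compactin (top_of_set F) F" using assms(1) by (simp add: compactin_subtopology)
  have ap: "blinfun_apply (Blinfun f) = f" if "f \<in> F" for f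
    using assms(2)[OF that] by (rule bounded_linear_Blinfun_apply)
  have "continuous_map (top_of_set F) euclidean (\<lambda>f. blinfun_apply (Blinfun f) x)" for x
  proof (rule continuous_map_eq)
    show "continuous_map (top_of_set F) euclidean (\<lambda>f. f x)"
      by (simp add: continuous_on_subset[OF continuous_on_product_coordinates])
  qed (simp add: ap)
  then show "continuous_map (top_of_set F) sot Blinfun"
    unfolding sot_def continuous_map_in_subtopology continuous_on_strong_operator_topo_iff_coordinatewise
    by (auto simp: bounded_operators_def ap assms(3))
qed

lemma continuous_map_sot_eval: "continuous_map sot euclidean (\<lambda>A. blinfun_apply A x)"
  unfolding sot_def
  by (intro continuous_map_from_subtopology strong_operator_topology_continuous_evaluation)

lemma closedin_sot_vimage:
  assumes "closed F"
  shows "closedin sot {A \<in> bounded_operators. blinfun_apply A \<in> F}"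
proof -
  have "continuous_map sot euclidean blinfun_apply"
    unfolding euclidean_product_topology[symmetric] continuous_map_componentwise_UNIV
    using continuous_map_sot_eval by blast
  from closedin_continuous_map_preimage[OF this] assms
  show ?thesis by (simp add: sot_def strong_operator_topology_topspace)
qed

text \<open>Total boundedness passes from the approximating compact sets to \<open>S\<close>, and
  then to its closure. Three errors of size \<open>e/4\<close> stay below \<open>e\<close>.\<close>

lemma compact_closure_of_approx:
  fixes S :: "'a::complete_space set"
  assumes "\<And>\<epsilon>. 0 < \<epsilon> \<Longrightarrow> \<exists>C. compact C \<and> (\<forall>s\<in>S. \<exists>c\<in>C. dist s c \<le> \<epsilon>)"
  shows "compact (closure S)"
proof -
  have "\<exists>k. finite k \<and> closure S \<subseteq> (\<Union>x\<in>k. ball x e)" if e: "0 < e" for e :: real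
  proof -
    obtain C where C: "compact C" "\<forall>s\<in>S. \<exists>c\<in>C. dist s c \<le> e / 4" using assms[of "e/4"] e by auto
    obtain k where k: "finite k" "C \<subseteq> (\<Union>x\<in>k. ball x (e / 4))"
      using C(1) e unfolding compact_eq_totally_bounded by (meson divide_pos_pos zero_less_numeral)
    have "closure S \<subseteq> (\<Union>x\<in>k. ball x e)"
    proof
      fix s assume "s \<in> closure S"
      then obtain t where t: "t \<in> S" "dist t s < e / 4"
        using e unfolding closure_approachable by (meson divide_pos_pos zero_less_numeral)
      then obtain c where c: "c \<in> C" "dist t c \<le> e / 4" using C(2) by blast
      then obtain x where "x \<in> k" "dist x c < e / 4" using k(2) by auto
      moreover have "dist x s \<le> dist x c + dist t c + dist t s"
        using dist_triangle[of x s c] dist_triangle[of c s t] by (simp add: dist_commute)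
      moreover from calculation have "dist x s < e"
        using t c e by linarith
      ultimately show "s \<in> (\<Union>x\<in>k. ball x e)" by auto
    qed
    then show ?thesis using k(1) by blast
  qed
  then show ?thesis by (simp add: compact_eq_totally_bounded complete_eq_closed)
qed

section \<open>The shift\<close>

definition weight :: "int \<Rightarrow> real" where
  "weight n = (if n < 0 then 1 else 2 * (n + 1) / (n + 2))"

lemma weight_ge_1: "1 \<le> weight n" and weight_le_2: "weight n \<le> 2"
  by (auto simp: weight_def field_simps)

definition shift :: "int ell2 \<Rightarrow>\<^sub>L int ell2" where
  "shift = weighted_translation (\<lambda>i. complex_of_real (weight (i - 1))) (-1)"

definition backshift :: "int ell2 \<Rightarrow>\<^sub>L int ell2" where
  "backshift = weighted_translation (\<lambda>i. 1 / complex_of_real (weight i)) 1"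

lemma abs_weight: "\<bar>weight n\<bar> = weight n"
  using weight_ge_1[of n] by simp

lemma cmod_weight: "cmod (complex_of_real (weight n)) \<le> 2"
  by (simp add: abs_weight weight_le_2)

lemma cmod_inverse_weight: "cmod (1 / complex_of_real (weight n)) \<le> 1"
  using weight_ge_1[of n] by (simp add: norm_divide abs_weight)

lemma coord_shift [simp]: "coord (shift x) i = complex_of_real (weight (i - 1)) * coord x (i - 1)"
  unfolding shift_def by (subst coord_weighted_translation[OF cmod_weight]) simp

lemma coord_backshift [simp]: "coord (backshift x) i = coord x (i + 1) / complex_of_real (weight i)"
  unfolding backshift_def by (subst coord_weighted_translation[OF cmod_inverse_weight]) simp

lemma weight_nonzero [simp]: "weight n \<noteq> 0"
  using weight_ge_1[of n] by auto

lemma shift_backshift [simp]: "shift (backshift x) = x" "backshift (shift x) = x"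
  by (auto intro!: ell2_eqI)

lemma shift_in_bounded_operators: "shift \<in> bounded_operators"
  unfolding shift_def by (rule weighted_translation_in_bounded_operators[OF cmod_weight])

lemma backshift_in_bounded_operators: "backshift \<in> bounded_operators"
  unfolding backshift_def by (rule weighted_translation_in_bounded_operators[OF cmod_inverse_weight])

lemma inverse_operators_shift: "inverse_operators shift backshift"
  by (auto simp: inverse_operators_def shift_in_bounded_operators backshift_in_bounded_operators
      intro!: blinfun_eqI)

lemma shift_unit_vector: "shift (unit_vector n) = complex_of_real (weight n) *\<^sub>C unit_vector (n + 1)"
  by (rule ell2_eqI) auto

lemma bilateral_weighted_shift_shift: "bilateral_weighted_shift shift"
  unfolding bilateral_weighted_shift_def
proof (intro conjI shift_in_bounded_operators exI allI)
  show "orthonormal_basis (unit_vector :: int \<Rightarrow> int ell2)" by (rule orthonormal_basis_unit_vector)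
  show "bounded (range (\<lambda>n. complex_of_real (weight n)))"
    using cmod_weight by (auto simp: bounded_iff simp del: norm_of_real)
qed (auto simp: shift_unit_vector)

section \<open>The inverse is not strongly compact\<close>

lemma norm_blinfun_contraction:
  assumes "norm A \<le> 1"
  shows "norm (blinfun_apply A x) \<le> norm x"
  using norm_blinfun[of A x] mult_right_mono[OF assms norm_ge_zero[of x]] by simp

lemma norm_backshift: "norm backshift \<le> 1"
  unfolding backshift_def by (rule norm_weighted_translation[OF cmod_inverse_weight])

text \<open>Moving down from index 0, only weights at negative indices occur, and these are
  1.\<close>

lemma backshift_power_unit_vector:
  "(blinfun_apply backshift ^^ j) (unit_vector 0) = unit_vector (- int j)"
  by (induction j) (auto intro!: ell2_eqI simp: weight_def)

text \<open>The algebra consists of elements of the operator type, so the power is first built as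
  such an operator by composition; the polynomial is then \<open>monom 1 j\<close>.\<close>

lemma backshift_power_in_unit_ball:
  "\<exists>A \<in> bounded_operators. A \<in> generated_algebra backshift \<and> norm A \<le> 1 \<and>
     blinfun_apply A = blinfun_apply backshift ^^ j"
proof -
  have "\<exists>A \<in> bounded_operators. norm A \<le> 1 \<and> blinfun_apply A = blinfun_apply backshift ^^ j"
  proof (induction j)
    case 0
    show ?case
      by (rule bexI[of _ id_blinfun])
        (auto simp: bounded_operators_def fun_eq_iff intro: norm_blinfun_bound)
  next
    case (Suc j)
    then obtain A where A: "A \<in> bounded_operators" "norm A \<le> 1"
      "blinfun_apply A = blinfun_apply backshift ^^ j" by blast
    have "norm (backshift (A x)) \<le> norm x" for x
      using norm_blinfun_contraction[OF norm_backshift] norm_blinfun_contraction[OF A(2)]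
        order.trans by blast
    then have "norm (backshift o\<^sub>L A) \<le> 1" by (intro norm_blinfun_bound) auto
    moreover have "backshift o\<^sub>L A \<in> bounded_operators"
      using A(1) backshift_in_bounded_operators by (simp add: bounded_operators_def)
    moreover have "blinfun_apply (backshift o\<^sub>L A) = blinfun_apply backshift ^^ Suc j"
      by (simp add: fun_eq_iff A(3))
    ultimately show ?case by blast
  qed
  then obtain A where A: "A \<in> bounded_operators" "norm A \<le> 1"
    "blinfun_apply A = blinfun_apply backshift ^^ j" by blast
  have "A x = (\<Sum>i\<le>degree (monom (1::complex) j). coeff (monom 1 j) i *\<^sub>C (blinfun_apply backshift ^^ i) x)"
    for x
  proof -
    have "(\<Sum>i\<le>j. coeff (monom (1::complex) j) i *\<^sub>C (blinfun_apply backshift ^^ i) x)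
        = (\<Sum>i\<in>{j}. (blinfun_apply backshift ^^ i) x)"
      by (rule sum.mono_neutral_cong_right) (auto simp: scaleC_one)
    then show ?thesis by (simp add: A(3) degree_monom_eq)
  qed
  then show ?thesis using A unfolding generated_algebra_def by blast
qed

lemma dist_unit_vector:
  assumes "i \<noteq> j"
  shows "1 \<le> dist (unit_vector i) (unit_vector j)"
  using coord_le_norm_ell2[of "unit_vector i - unit_vector j" i] assms by (simp add: dist_norm)

text \<open>Evaluation at \<open>unit_vector 0\<close> would map the compact closure to a compact
  set. That set contains all \<open>unit_vector (- int j)\<close>, whose mutual distances are at
  least 1, so none of their subsequences is Cauchy.\<close>

lemma not_strongly_compact_backshift: "\<not> strongly_compact_operator backshift"
proof
  let ?B = "{A \<in> generated_algebra backshift. norm A \<le> 1}"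
  \<comment> \<open>A set is known to lie in its closure only within the topspace of
    \<open>sot\<close>, which is \<open>bounded_operators\<close>.\<close>
  let ?B' = "{A \<in> generated_algebra backshift. norm A \<le> 1} \<inter> bounded_operators"
  assume "strongly_compact_operator backshift"
  then have "compactin sot (sot closure_of ?B)"
    by (simp add: strongly_compact_operator_def strongly_compact_algebra_def)
  from image_compactin[OF this continuous_map_sot_eval[of "unit_vector 0"]]
  have cpt: "compact ((\<lambda>A. blinfun_apply A (unit_vector 0)) ` (sot closure_of ?B))" (is "compact ?C")
    by simp
  have mem: "unit_vector (- int j) \<in> ?C" for j
  proof -
    obtain A where A: "A \<in> ?B'" "blinfun_apply A = blinfun_apply backshift ^^ j"
      using backshift_power_in_unit_ball[of j] by blast
    have "A \<in> sot closure_of ?B'"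
      using A(1) closure_of_subset[of ?B' sot] by (auto simp: sot_def strong_operator_topology_topspace)
    then have "A \<in> sot closure_of ?B" using closure_of_mono[of ?B' ?B sot] by blast
    then show ?thesis
      by (rule rev_image_eqI) (simp only: A(2) backshift_power_unit_vector)
  qed
  obtain l r where "strict_mono r" "((\<lambda>j. unit_vector (- int j)) \<circ> r) \<longlonglongrightarrow> l"
    by (rule seq_compactE[OF compact_imp_seq_compact[OF cpt]], rule allI, rule mem)
  then have r: "strict_mono r" and cauchy: "Cauchy (\<lambda>n. unit_vector (- int (r n)))"
    by (auto simp: o_def dest: LIMSEQ_imp_Cauchy)
  obtain N where "\<And>m n. m \<ge> N \<Longrightarrow> n \<ge> N \<Longrightarrow>
      dist (unit_vector (- int (r m))) (unit_vector (- int (r n))) < 1"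
    using metric_CauchyD[OF cauchy zero_less_one] by blast
  from this[of N "Suc N"] dist_unit_vector[of "- int (r N)" "- int (r (Suc N))"]
  show False using r by (simp add: strict_mono_eq)
qed

section \<open>The shift is strongly compact\<close>

text \<open>A set of plain functions, so that Tychonoff applies in the product topology. Every
  condition survives pointwise limits, and together they hold on the unit ball of the algebra
  generated by \<open>shift\<close>.\<close>

definition analytic_contractions :: "(int ell2 \<Rightarrow> int ell2) set" where
  "analytic_contractions = {f. (\<forall>x y. f (x + y) = f x + f y) \<and> (\<forall>c x. f (c *\<^sub>C x) = c *\<^sub>C f x) \<and>
     (\<forall>x. norm (f x) \<le> norm x) \<and> (\<forall>x. f (shift x) = shift (f x)) \<and>
     (\<forall>j<0. coord (f (unit_vector 0)) j = 0)}"

lemma closed_analytic_contractions: "closed analytic_contractions"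
proof -
  have "continuous_on UNIV (\<lambda>f :: int ell2 \<Rightarrow> int ell2. c *\<^sub>C f x)"
       "continuous_on UNIV (\<lambda>f :: int ell2 \<Rightarrow> int ell2. shift (f x))"
       "continuous_on UNIV (\<lambda>f :: int ell2 \<Rightarrow> int ell2. coord (f x) j)" for c x j
    by (intro bounded_linear.continuous_on[OF bounded_linear_scaleC_right]
        bounded_linear.continuous_on[OF blinfun.bounded_linear_right]
        bounded_linear.continuous_on[OF bounded_linear_coord] continuous_on_product_coordinates)+
  then show ?thesis
    unfolding analytic_contractions_def
    by (intro closed_Collect_conj closed_Collect_all closed_Collect_imp closed_Collect_eq closed_Collect_le
        continuous_on_add continuous_on_norm continuous_on_const continuous_on_product_coordinates) auto
qed

lemma analytic_contractionsD:
  assumes "f \<in> analytic_contractions"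
  shows "f (x + y) = f x + f y" "f (c *\<^sub>C x) = c *\<^sub>C f x" "norm (f x) \<le> norm x"
    "f (shift x) = shift (f x)" "j < 0 \<Longrightarrow> coord (f (unit_vector 0)) j = 0"
    "f (backshift x) = backshift (f x)" "f (x - y) = f x - f y"
    "f ((blinfun_apply shift ^^ m) x) = (blinfun_apply shift ^^ m) (f x)"
proof -
  have *: "f (x + y) = f x + f y" "f (c *\<^sub>C x) = c *\<^sub>C f x" "norm (f x) \<le> norm x"
    "f (shift x) = shift (f x)" "j < 0 \<Longrightarrow> coord (f (unit_vector 0)) j = 0" for x y c j
    using assms by (auto simp: analytic_contractions_def)
  show "f (x + y) = f x + f y" "f (c *\<^sub>C x) = c *\<^sub>C f x" "norm (f x) \<le> norm x"
    "f (shift x) = shift (f x)" "j < 0 \<Longrightarrow> coord (f (unit_vector 0)) j = 0" by fact+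
  show "f (backshift x) = backshift (f x)"
    using *(4)[of "backshift x"] by (metis shift_backshift)
  show "f (x - y) = f x - f y"
    using *(1)[of "x - y" y] by simp
  show "f ((blinfun_apply shift ^^ m) x) = (blinfun_apply shift ^^ m) (f x)"
    by (induction m) (simp_all add: *(4))
qed

section \<open>Tail estimate for the images of \<open>unit_vector 0\<close>\<close>

text \<open>The product of the weights at \<open>j, ..., j + m - 1\<close> telescopes, since each is
  \<open>2(n+1)/(n+2)\<close>.\<close>

lemma coord_shift_power:
  assumes "0 \<le> j"
  shows "coord ((blinfun_apply shift ^^ m) x) (j + int m) = 2 ^ m * (of_int j + 1) / (of_int j + of_nat m + 1) * coord x j"
proof (induction m)
  case 0
  have "complex_of_int (j + 1) \<noteq> 0"
    using assms by (simp only: of_int_eq_0_iff)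
  then show ?case by simp
next
  case (Suc m)
  define d where "d = complex_of_int j + of_nat m + 1"
  have "complex_of_int (j + int m + 1) \<noteq> 0"
    using assms by (simp only: of_int_eq_0_iff)
  then have d: "d \<noteq> 0" by (simp add: d_def)
  have w: "complex_of_real (weight (j + int m)) = 2 * d / (d + 1)"
    using assms by (simp add: weight_def d_def add.assoc)
  have "coord ((blinfun_apply shift ^^ Suc m) x) (j + int (Suc m))
      = complex_of_real (weight (j + int m)) * coord ((blinfun_apply shift ^^ m) x) (j + int m)"
    by simp
  also have "\<dots> = 2 ^ Suc m * (of_int j + 1) / (of_int j + of_nat (Suc m) + 1) * coord x j"
  proof -
    have d': "complex_of_int j + of_nat (Suc m) + 1 = d + 1" by (simp add: d_def)
    then show ?thesis
      unfolding Suc.IH w d' d_def[symmetric] using d by simp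
  qed
  finally show ?case .
qed

lemma shift_power_unit_vector:
  "(blinfun_apply shift ^^ m) (unit_vector 0) = (2 ^ m / (of_nat m + 1)) *\<^sub>C unit_vector (int m)"
proof (induction m)
  case (Suc m)
  have "complex_of_nat m + 1 \<noteq> 0" "complex_of_nat m + 2 \<noteq> 0"
    using of_nat_neq_0[of m, where 'a = complex] of_nat_neq_0[of "Suc m", where 'a = complex]
    by (simp_all add: add.commute)
  then have "2 ^ m / (of_nat m + 1) * complex_of_real (weight (int m)) = 2 ^ Suc m / (of_nat (Suc m) + 1)"
    by (simp add: weight_def divide_simps) (simp add: algebra_simps)
  moreover have "shift (c *\<^sub>C x) = c *\<^sub>C shift x" for c x
    using shift_in_bounded_operators by (simp add: bounded_operators_def)
  ultimately show ?case
    using Suc by (simp add: shift_unit_vector scaleC_scaleC add.commute)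
qed (simp add: scaleC_one)

text \<open>For \<open>j \<ge> m\<close>, coordinate \<open>j\<close> of
  \<open>f (unit_vector 0)\<close> reappears at \<open>j + m\<close> after \<open>m\<close> shifts,
  enlarged by at least \<open>2^m / 2\<close>. The shifted vector is the image under the contraction
  \<open>f\<close> of a vector of norm \<open>2^m / (m+1)\<close>.\<close>

lemma tail_bound:
  assumes f: "f \<in> analytic_contractions"
  shows "norm (f (unit_vector 0) - (\<Sum>j\<in>{0..<int m}. coord (f (unit_vector 0)) j *\<^sub>C unit_vector j))
    \<le> 2 / (m + 1)"
proof -
  let ?x = "f (unit_vector 0)" and ?u = "(blinfun_apply shift ^^ m) (unit_vector 0)"
  let ?y = "?x - (\<Sum>j\<in>{0..<int m}. coord ?x j *\<^sub>C unit_vector j)"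
  \<comment> \<open>The truncation removes the indices from 0 to \<open>m - 1\<close>; negative
    coordinates vanish because \<open>f\<close> is analytic.\<close>
  have y: "coord ?y j = (if int m \<le> j then coord ?x j else 0)" for j
    using analytic_contractionsD(5)[OF f, of j] by (simp add: if_distrib[of "(*) _"] cong: if_cong)
  have "cmod (coord ?y j) \<le> 2 / 2 ^ m * cmod (coord (f ?u) (j + int m))" for j
  proof (cases "int m \<le> j")
    case True
    then have j: "0 \<le> j" "real m \<le> real_of_int j" by auto
    have "coord (f ?u) (j + int m) = complex_of_real (2 ^ m * (j + 1) / (j + m + 1)) * coord ?x j"
      unfolding analytic_contractionsD(8)[OF f] coord_shift_power[OF j(1)] by simp
    then have "2 / 2 ^ m * cmod (coord (f ?u) (j + int m)) = 2 * (j + 1) / (j + m + 1) * cmod (coord ?x j)"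
      using j by (simp only: norm_mult norm_of_real) (simp add: abs_mult)
    \<comment> \<open>This is where \<open>m \<le> j\<close> enters: it gives
      \<open>j + m + 1 \<le> 2(j+1)\<close>.\<close>
    moreover have "1 \<le> real_of_int (2 * (j + 1)) / (j + m + 1)"
      using j by (simp add: field_simps)
    then have "1 * cmod (coord ?x j) \<le> real_of_int (2 * (j + 1)) / (j + m + 1) * cmod (coord ?x j)"
      by (rule mult_right_mono) simp
    ultimately show ?thesis using True unfolding y by simp
  qed (simp add: y del: coord_simps coord_sum)
  then have "norm ?y \<le> 2 / 2 ^ m * norm (f ?u)"
    by (intro norm_dominated[where g = "\<lambda>j. j + int m"]) (auto simp: inj_def)
  also have "\<dots> \<le> 2 / 2 ^ m * norm ?u"
    by (intro mult_left_mono analytic_contractionsD(3)[OF f]) simp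
  also have "norm ?u = 2 ^ m / (m + 1)"
  proof -
    have "cmod (complex_of_nat m + 1) = real m + 1"
      by (metis norm_of_nat of_nat_Suc add.commute)
    then show ?thesis
      by (simp add: shift_power_unit_vector norm_scaleC norm_divide norm_power)
  qed
  finally show ?thesis by (simp add: add.commute)
qed

section \<open>Precompact orbits\<close>

text \<open>Stated through a compact superset: this is the pointwise hypothesis of
  \<open>compact_pointwise_bounded\<close>, and it passes to linear images and sums without taking
  closures.\<close>

definition precompact_orbit :: "int ell2 \<Rightarrow> bool" where
  "precompact_orbit x \<longleftrightarrow> (\<exists>C. compact C \<and> (\<forall>f\<in>analytic_contractions. f x \<in> C))"

lemma precompact_orbitI:
  assumes "\<And>\<epsilon>. 0 < \<epsilon> \<Longrightarrow>
    \<exists>C. compact C \<and> (\<forall>f\<in>analytic_contractions. \<exists>c\<in>C. dist (f x) c \<le> \<epsilon>)"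
  shows "precompact_orbit x"
  unfolding precompact_orbit_def
proof (intro exI conjI)
  show "compact (closure ((\<lambda>f. f x) ` analytic_contractions))"
    using assms by (intro compact_closure_of_approx) simp
  show "\<forall>f\<in>analytic_contractions. f x \<in> closure ((\<lambda>f. f x) ` analytic_contractions)"
    by (meson closure_subset imageI subsetD)
qed

text \<open>The first \<open>m\<close> coordinates have modulus at most 1 and so give vectors in one
  compact set; the remaining tail is small uniformly in \<open>f\<close>.\<close>

lemma precompact_orbit_unit_vector_0: "precompact_orbit (unit_vector 0)"
proof (rule precompact_orbitI)
  fix \<epsilon> :: real assume "0 < \<epsilon>"
  \<comment> \<open>Half of \<open>\<epsilon>\<close> compensates the factor 2 in the tail bound
    \<open>2/(m+1)\<close>.\<close>
  then obtain m where m: "1 / real (Suc m) < \<epsilon> / 2"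
    using nat_approx_posE[of "\<epsilon> / 2"] by auto
  obtain C where C: "compact C" "\<And>c. \<forall>j\<in>{0..<int m}. cmod (c j) \<le> 1 \<Longrightarrow>
      (\<Sum>j\<in>{0..<int m}. c j *\<^sub>C unit_vector j :: int ell2) \<in> C"
    using compact_bounded_combinations[of "{0..<int m}" 1 unit_vector] by auto
  show "\<exists>C. compact C \<and> (\<forall>f\<in>analytic_contractions. \<exists>c\<in>C. dist (f (unit_vector 0)) c \<le> \<epsilon>)"
  proof (intro exI conjI ballI)
    fix f assume f: "f \<in> analytic_contractions"
    let ?y = "\<Sum>j\<in>{0..<int m}. coord (f (unit_vector 0)) j *\<^sub>C (unit_vector j :: int ell2)"
    have "cmod (coord (f (unit_vector 0)) j) \<le> 1" for j
      using coord_le_norm_ell2[of "f (unit_vector 0)" j] analytic_contractionsD(3)[OF f, of "unit_vector 0"]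
      by simp
    then have "?y \<in> C" by (intro C(2)) simp
    moreover have "dist (f (unit_vector 0)) ?y \<le> \<epsilon>"
      using tail_bound[OF f, of m] m by (simp add: dist_norm add.commute)
    ultimately show "\<exists>c\<in>C. dist (f (unit_vector 0)) c \<le> \<epsilon>" by blast
  qed fact
qed

text \<open>If \<open>C\<close> contains the orbit of \<open>x\<close>, commutation places the orbit
  of \<open>T x\<close> in the compact image of \<open>C\<close> under \<open>T\<close>.\<close>

lemma precompact_orbit_bounded_linear:
  assumes "precompact_orbit x" "bounded_linear T" "\<And>f. f \<in> analytic_contractions \<Longrightarrow> f (T x) = T (f x)"
  shows "precompact_orbit (T x)"
proof -
  obtain C where "compact C" "\<forall>f\<in>analytic_contractions. f x \<in> C"
    using assms(1) unfolding precompact_orbit_def by blast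
  then show ?thesis unfolding precompact_orbit_def
    using assms(2,3) by (intro exI[of _ "T ` C"]) (auto intro!: compact_continuous_image linear_continuous_on)
qed

lemma precompact_orbit_scaleC: "precompact_orbit x \<Longrightarrow> precompact_orbit (c *\<^sub>C x)"
  by (rule precompact_orbit_bounded_linear) (auto intro: bounded_linear_scaleC_right analytic_contractionsD)

lemma precompact_orbit_shift: "precompact_orbit x \<Longrightarrow> precompact_orbit (shift x)"
  by (rule precompact_orbit_bounded_linear) (auto intro: blinfun.bounded_linear_right analytic_contractionsD)

lemma precompact_orbit_backshift: "precompact_orbit x \<Longrightarrow> precompact_orbit (backshift x)"
  by (rule precompact_orbit_bounded_linear) (auto intro: blinfun.bounded_linear_right analytic_contractionsD)

lemma precompact_orbit_add:
  assumes "precompact_orbit x" "precompact_orbit y"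
  shows "precompact_orbit (x + y)"
proof -
  obtain C D where "compact C" "\<forall>f\<in>analytic_contractions. f x \<in> C"
    "compact D" "\<forall>f\<in>analytic_contractions. f y \<in> D"
    using assms unfolding precompact_orbit_def by blast
  then show ?thesis unfolding precompact_orbit_def
    by (intro exI[of _ "{u + v | u v. u \<in> C \<and> v \<in> D}"])
      (auto simp: compact_sums analytic_contractionsD(1))
qed

text \<open>Induction in both directions from 0: neighbouring unit vectors are multiples of images
  under \<open>shift\<close> or \<open>backshift\<close>, and analytic contractions commute with
  both.\<close>

lemma precompact_orbit_unit_vector: "precompact_orbit (unit_vector n)"
proof (induction n rule: int_induct[where k = 0])
  case base
  show ?case by (rule precompact_orbit_unit_vector_0)
next
  case (step1 i)
  have "unit_vector (i + 1) = (1 / complex_of_real (weight i)) *\<^sub>C shift (unit_vector i)"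
    by (simp add: shift_unit_vector scaleC_scaleC scaleC_one)
  then show ?case using step1(2) precompact_orbit_scaleC precompact_orbit_shift by metis
next
  case (step2 i)
  have "unit_vector (i - 1) = complex_of_real (weight (i - 1)) *\<^sub>C backshift (unit_vector i)"
    by (rule ell2_eqI) auto
  then show ?case using step2(2) precompact_orbit_scaleC precompact_orbit_backshift by metis
qed

lemma precompact_orbit_sum:
  assumes "finite F" "\<And>i. i \<in> F \<Longrightarrow> precompact_orbit (v i)"
  shows "precompact_orbit (sum v F)"
  using assms
proof (induction F)
  case empty
  have "precompact_orbit (0 *\<^sub>C unit_vector 0)"
    by (intro precompact_orbit_scaleC precompact_orbit_unit_vector_0)
  then show ?case by simp
qed (auto intro: precompact_orbit_add)

text \<open>Contractivity gives the approximation of \<open>x\<close> by a finite combination the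
  same error along the whole orbit.\<close>

lemma precompact_orbit: "precompact_orbit x"
proof (rule precompact_orbitI)
  fix \<epsilon> :: real assume "0 < \<epsilon>"
  then obtain F where F: "finite F" "norm (x - (\<Sum>i\<in>F. coord x i *\<^sub>C unit_vector i)) < \<epsilon>"
    using finite_truncation_approx by blast
  let ?y = "\<Sum>i\<in>F. coord x i *\<^sub>C (unit_vector i :: int ell2)"
  have "precompact_orbit ?y"
    by (intro precompact_orbit_sum precompact_orbit_scaleC precompact_orbit_unit_vector F(1))
  then obtain C where C: "compact C" "\<forall>f\<in>analytic_contractions. f ?y \<in> C"
    unfolding precompact_orbit_def by blast
  have "dist (f x) (f ?y) \<le> \<epsilon>" if "f \<in> analytic_contractions" for f
    using analytic_contractionsD(3,7)[OF that, of "x - ?y"] analytic_contractionsD(7)[OF that, of x ?y] F(2)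
    by (simp add: dist_norm)
  then show "\<exists>C. compact C \<and> (\<forall>f\<in>analytic_contractions. \<exists>c\<in>C. dist (f x) c \<le> \<epsilon>)"
    using C by blast
qed

section \<open>Strong compactness of the algebra generated by \<open>shift\<close>\<close>

lemma generated_algebra_shift_subset:
  assumes "A \<in> generated_algebra shift" "norm A \<le> 1"
  shows "A \<in> bounded_operators \<and> blinfun_apply A \<in> analytic_contractions"
proof -
  obtain p where A: "\<And>x. A x = (\<Sum>i\<le>degree p. coeff p i *\<^sub>C (blinfun_apply shift ^^ i) x)"
    using assms(1) unfolding generated_algebra_def by blast
  have sC: "shift (c *\<^sub>C x) = c *\<^sub>C shift x" for c x
    using shift_in_bounded_operators by (simp add: bounded_operators_def)
  have "(blinfun_apply shift ^^ i) (c *\<^sub>C x) = c *\<^sub>C (blinfun_apply shift ^^ i) x" for c x i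
    by (induction i) (simp_all add: sC)
  then have "A (c *\<^sub>C x) = c *\<^sub>C A x" for c x
    by (simp add: A complex_vector.scale_sum_right scaleC_scaleC mult.commute)
  moreover have "A (shift x) = shift (A x)" for x
    by (simp add: A blinfun.sum_right sC funpow_swap1)
  moreover have "norm (A x) \<le> norm x" for x
    using assms(2) by (rule norm_blinfun_contraction)
  \<comment> \<open>Polynomials contain only nonnegative powers of \<open>shift\<close>, which move
    \<open>unit_vector 0\<close> to multiples of unit vectors of nonnegative index.\<close>
  moreover have "coord (A (unit_vector 0)) j = 0" if "j < 0" for j
    using that by (simp add: A shift_power_unit_vector)
  ultimately show ?thesis
    by (simp add: bounded_operators_def analytic_contractions_def blinfun.add_right)
qed

text \<open>\<open>?K\<close> is closed in \<open>sot\<close> and lies in the compact image of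
  \<open>analytic_contractions\<close> under \<open>Blinfun\<close>, so it is compact. It contains
  the unit ball of the algebra, hence also the closure of that ball.\<close>

lemma strongly_compact_shift: "strongly_compact_operator shift"
proof -
  let ?K = "{A \<in> bounded_operators. blinfun_apply A \<in> analytic_contractions}"
  have lin: "bounded_linear f" if "f \<in> analytic_contractions" for f
    by (rule bounded_linear_intro[of _ 1])
      (use analytic_contractionsD[OF that] in \<open>auto simp: scaleR_scaleC\<close>)
  have "compact analytic_contractions"
    using closed_analytic_contractions precompact_orbit unfolding precompact_orbit_def
    by (rule compact_pointwise_bounded)
  then have "compactin sot (Blinfun ` analytic_contractions)"
    by (rule compactin_sot_Blinfun_image) (auto intro: lin analytic_contractionsD)
  moreover have "?K \<subseteq> Blinfun ` analytic_contractions"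
    by (auto intro!: image_eqI[of _ Blinfun "blinfun_apply _"] simp: blinfun_apply_inverse)
  moreover have "closedin sot ?K" by (rule closedin_sot_vimage[OF closed_analytic_contractions])
  ultimately have K: "compactin sot ?K" "closedin sot ?K" using closed_compactin by blast+
  have "sot closure_of {A \<in> generated_algebra shift. norm A \<le> 1} \<subseteq> ?K"
    using generated_algebra_shift_subset by (intro closure_of_minimal K(2)) auto
  then show ?thesis
    unfolding strongly_compact_operator_def strongly_compact_algebra_def
    by (intro closed_compactin[OF K(1)]) auto
qed

theorem mainTheorem5:
  shows "infinite_dimensional TYPE(int ell2) \<and>
         separable_space (euclidean :: int ell2 topology) \<and>
         (\<exists>W V :: int ell2 \<Rightarrow>\<^sub>L int ell2.
            bilateral_weighted_shift W \<and> inverse_operators W V \<and>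
            strongly_compact_operator W \<and> \<not> strongly_compact_operator V)"
  using infinite_dimensional_ell2[where 'i = int] separable_space_ell2 bilateral_weighted_shift_shift
    inverse_operators_shift strongly_compact_shift not_strongly_compact_backshift
  by (auto simp: infinite_UNIV_int)

end
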